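(* Let $a<b$ be real numbers, let $\Omega_\varepsilon=(a,b)\times(0,\varepsilon)\subset\mathbb R^2$, and let $s_\varepsilon\in(0,\frac12)$ with $s_\varepsilon\to0$ as $\varepsilon\to0$ be such that the limit $\varrho=\lim_{\varepsilon\to0}\varepsilon^{s_\varepsilon}\in[0,1]$ exists. Let $u:(a,b)\times(0,\varepsilon)\to\mathbb R$ be such that $u(x_1,x_2)=v(x_1)$, with $v:(a,b)\to\mathbb R$ piecewise constant. Then, as $\varepsilon\to0$, $$\lfloor u\rfloor_{s_\varepsilon}^2(\Omega_\varepsilon)=\frac{\varepsilon^{2-2s_\varepsilon}}{s_\varepsilon}(1-\varrho^2)\sum_{t\in S(v)}|v(t^+)-v(t^-)|^2+o\Big(\frac{\varepsilon^{2-2s_\varepsilon}}{s_\varepsilon}\Big).$$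
   Context: For measurable $A\subset\mathbb R^2$ and $s\in(0,1)$, $\lfloor u\rfloor_s^2(A)=\int_A\int_A\frac{|u(x)-u(y)|^2}{|x-y|^{2+2s}}\,dx\,dy$. A function $v:(a,b)\to\mathbb R$ is piecewise constant if $v=\sum_{j=1}^{N+1}\lambda_j\chi_{(a_{j-1},a_j)}$ (almost everywhere) for some finite partition $a=a_0<a_1<\dots<a_{N+1}=b$ and $\lambda_j\in\mathbb R$. $S(v)$ is its (finite) jump set in $(a,b)$, and $v(t^\pm)$ are the right and left limits at $t$. *)

theory Defs
  imports "HOL-Analysis.Analysis" "HOL-Library.Landau_Symbols"
begin

text \<open>The plane is \<^typ>\<open>real \<times> real\<close>, whose norm is the Euclidean one. The double integral is
  a Lebesgue integral with values in $[0,\infty]$; on the diagonal the quotient is \<open>0 / 0 = 0\<close>.\<close>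

definition gagliardo_sq :: "real \<Rightarrow> (real \<times> real) set \<Rightarrow> (real \<times> real \<Rightarrow> real) \<Rightarrow> ennreal" where
  "gagliardo_sq s A u =
     (\<integral>\<^sup>+x\<in>A. (\<integral>\<^sup>+y\<in>A. ennreal (\<bar>u x - u y\<bar>\<^sup>2 / norm (x - y) powr (2 + 2 * s)) \<partial>lebesgue) \<partial>lebesgue)"

definition piecewise_constant_on :: "real \<Rightarrow> real \<Rightarrow> (real \<Rightarrow> real) \<Rightarrow> bool" where
  "piecewise_constant_on a b v \<longleftrightarrow>
     (\<exists>(N::nat) (p::nat \<Rightarrow> real) (c::nat \<Rightarrow> real).
        p 0 = a \<and> p (N + 1) = b \<and> (\<forall>i\<le>N. p i < p (i + 1)) \<and>
        (AE x in lebesgue. x \<in> {a<..<b} \<longrightarrow>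
           v x = (\<Sum>j=1..N+1. c j * indicator {p (j - 1)<..<p j} x)))"

text \<open>A piecewise constant function is only determined almost everywhere, so its one-sided limits
  are taken along the points outside an arbitrary null set: a property holds eventually for
  \<open>ess_at_right t\<close> iff it holds for almost every \<open>x\<close> in some interval $(t, t + \delta)$.\<close>

definition ess_at_right :: "real \<Rightarrow> real filter" where
  "ess_at_right t = inf (at_right t) (ae_filter lebesgue)"

definition ess_at_left :: "real \<Rightarrow> real filter" where
  "ess_at_left t = inf (at_left t) (ae_filter lebesgue)"

definition right_lim :: "(real \<Rightarrow> real) \<Rightarrow> real \<Rightarrow> real" where
  "right_lim v t = Lim (ess_at_right t) v"

definition left_lim :: "(real \<Rightarrow> real) \<Rightarrow> real \<Rightarrow> real" where
  "left_lim v t = Lim (ess_at_left t) v"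

definition jump_set :: "real \<Rightarrow> real \<Rightarrow> (real \<Rightarrow> real) \<Rightarrow> real set" where
  "jump_set a b v = {t \<in> {a<..<b}. \<exists>l r. (v \<longlongrightarrow> l) (ess_at_left t) \<and> (v \<longlongrightarrow> r) (ess_at_right t) \<and> l \<noteq> r}"

definition thin_rect :: "real \<Rightarrow> real \<Rightarrow> real \<Rightarrow> (real \<times> real) set" where
  "thin_rect a b \<epsilon> = {a<..<b} \<times> {0<..<\<epsilon>}"

end

theory Submission
  imports Defs
begin

text \<open>Write \<open>x = (x\<^sub>1, x\<^sub>2)\<close> and \<open>y = (x\<^sub>1 \<plusminus> h, x\<^sub>2 \<plusminus> z)\<close>. By symmetry the seminorm equals
  $4 \int_0^\infty \Phi(h) \int_0^\<epsilon> (\<epsilon> - z) (h^2 + z^2)^{-1-s} \, dz \, dh$ with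
  $\Phi(h) = \int |v(x + h) - v(x)|^2 \, dx$. If \<open>h\<close> is below the length \<open>m\<close> of the shortest piece,
  only jumps contribute and $\Phi(h) = S h$, where \<open>S\<close> is the sum of the squared jumps; larger \<open>h\<close>
  contribute $O(\<epsilon>^2)$. Since $\int_0^m h (h^2 + z^2)^{-1-s} \, dh = (z^{-2s} - (m^2 + z^2)^{-s}) / (2s)$
  and $0 < z < \<epsilon>$, the main term is squeezed between explicit multiples of $\<epsilon>^{2-2s}/s$, both of
  which tend to $S (1 - \varrho^2)$.\<close>

section \<open>Reduction to increments\<close>

text \<open>After the substitution \<open>y = x + h\<close> and Tonelli, the inner integral is an
  even function of \<open>h\<close>: a translation of \<open>x\<close> by \<open>h\<close> followed
  by the symmetry of \<open>F\<close> exchanges \<open>h\<close> and \<open>- h\<close>. So the two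
  half-lines contribute equally and \<open>h = 0\<close> is null. The result serves for the vertical
  pair of variables and again for the horizontal pair.\<close>

lemma nn_integral_symmetric_kernel:
  fixes F :: "real \<Rightarrow> real \<Rightarrow> ennreal"
  assumes F [measurable]: "case_prod F \<in> borel_measurable (borel \<Otimes>\<^sub>M borel)"
    and sym: "\<And>x y. F x y = F y x"
  shows "(\<integral>\<^sup>+x. \<integral>\<^sup>+y. F x y \<partial>lborel \<partial>lborel)
    = 2 * (\<integral>\<^sup>+h\<in>{0<..}. (\<integral>\<^sup>+x. F x (x + h) \<partial>lborel) \<partial>lborel)"
proof -
  define g where "g h = (\<integral>\<^sup>+x. F x (x + h) \<partial>lborel)" for h
  have [measurable]: "g \<in> borel_measurable borel"
    unfolding g_def by measurable
  have g_even: "g (- h) = g h" for h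
  proof -
    have "g (- h) = (\<integral>\<^sup>+x. F (h + 1 * x) (h + 1 * x + - h) \<partial>lborel)"
      unfolding g_def by (subst nn_integral_real_affine[where c = 1 and t = h]) auto
    also have "\<dots> = g h"
      unfolding g_def by (subst sym) (simp add: add.commute)
    finally show ?thesis .
  qed
  have "(\<integral>\<^sup>+x. \<integral>\<^sup>+y. F x y \<partial>lborel \<partial>lborel) = (\<integral>\<^sup>+x. \<integral>\<^sup>+h. F x (x + h) \<partial>lborel \<partial>lborel)"
  proof (rule nn_integral_cong)
    fix x :: real
    show "(\<integral>\<^sup>+y. F x y \<partial>lborel) = (\<integral>\<^sup>+h. F x (x + h) \<partial>lborel)"
      by (subst nn_integral_real_affine[where c = 1 and t = x]) auto
  qed
  also have "\<dots> = (\<integral>\<^sup>+h. g h \<partial>lborel)"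
    unfolding g_def by (rule lborel_pair.Fubini') measurable
  also have "\<dots> = (\<integral>\<^sup>+h. g h * indicator {0<..} h + g h * indicator {..<0} h \<partial>lborel)"
    by (intro nn_integral_cong_AE eventually_mono[OF AE_lborel_singleton[of 0]])
      (auto split: split_indicator)
  also have "\<dots> = (\<integral>\<^sup>+h\<in>{0<..}. g h \<partial>lborel) + (\<integral>\<^sup>+h\<in>{..<0}. g h \<partial>lborel)"
    by (rule nn_integral_add) auto
  also have "(\<integral>\<^sup>+h\<in>{..<0}. g h \<partial>lborel) = (\<integral>\<^sup>+h\<in>{0<..}. g h \<partial>lborel)"
    by (subst nn_integral_real_affine[where c = "-1" and t = 0])
      (auto simp: g_even indicator_def intro!: nn_integral_cong)
  finally show ?thesis
    by (simp add: g_def mult_2)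
qed

text \<open>Carries an a.e. identity on the line over to the plane. The exceptional set lies in a
  Borel null set \<open>N\<close>, and the cylinder \<open>N \<times> UNIV\<close> is null in the
  product; going through \<open>lborel\<close> is what gives access to the product
  structure.\<close>

lemma AE_fst_lebesgue:
  assumes "AE x in lebesgue. P (x::real)"
  shows "AE z in (lebesgue :: (real \<times> real) measure). P (fst z)"
proof -
  from assms have "AE x in lborel. P x"
    by (simp add: AE_completion_iff)
  then obtain N where N: "N \<in> null_sets lborel" "{x \<in> space lborel. \<not> P x} \<subseteq> N"
    unfolding eventually_ae_filter by blast
  have "N \<times> (UNIV :: real set) \<in> null_sets (lborel \<Otimes>\<^sub>M lborel)"
    using N(1) by (intro lborel.times_in_null_sets1) auto
  then have "AE z in (lborel :: (real \<times> real) measure). P (fst z)"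
    using N(2) by (intro AE_I'[where N = "N \<times> UNIV"]) (auto simp: lborel_prod)
  then show ?thesis
    by (rule AE_completion)
qed

text \<open>With \<open>h = \<bar>x\<^sub>1 - y\<^sub>1\<bar>\<close> fixed, integrating the kernel over the two vertical variables in
  $(0, \<epsilon>)$ gives twice this integral over \<open>z = \<bar>x\<^sub>2 - y\<^sub>2\<bar>\<close>. The weight needs no upper bound on \<open>z\<close>
  because \<open>ennreal\<close> sends negative reals to 0.\<close>

definition strip_kernel :: "real \<Rightarrow> real \<Rightarrow> real \<Rightarrow> ennreal"
  where "strip_kernel s \<epsilon> h = (\<integral>\<^sup>+z\<in>{0<..}. ennreal (\<epsilon> - z) * ennreal (1 / (h\<^sup>2 + z\<^sup>2) powr (1 + s)) \<partial>lborel)"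

lemma strip_kernel_measurable [measurable]: "strip_kernel s \<epsilon> \<in> borel_measurable borel"
  unfolding strip_kernel_def by measurable

text \<open>Here \<open>w\<close> is a Borel representative, so \<open>u\<close> enters only through
  its a.e. class. The integrand splits into a horizontal factor \<open>F\<close>, a vertical factor
  \<open>H\<close> and a kernel \<open>k\<close> of the coordinate differences. The constant 4 is
  one factor 2 from symmetry in the vertical variables times one from symmetry in the horizontal
  ones.\<close>

lemma gagliardo_sq_thin_rect:
  fixes w :: "real \<Rightarrow> real" and u :: "real \<times> real \<Rightarrow> real"
  assumes [measurable]: "w \<in> borel_measurable borel"
    and u: "AE z in lebesgue. z \<in> thin_rect a b \<epsilon> \<longrightarrow> u z = w (fst z)"
  defines "\<Phi> \<equiv> \<lambda>h. \<integral>\<^sup>+x. ennreal ((w x - w (x + h))\<^sup>2) * indicator {a<..<b} x * indicator {a<..<b} (x + h) \<partial>lborel"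
  shows "gagliardo_sq s (thin_rect a b \<epsilon>) u
    = 4 * (\<integral>\<^sup>+h\<in>{0<..}. \<Phi> h * strip_kernel s \<epsilon> h \<partial>lborel)"
proof -
  define k where "k p q = ennreal (1 / (p\<^sup>2 + q\<^sup>2) powr (1 + s))" for p q :: real
  define F where "F x y = ennreal ((w x - w y)\<^sup>2) * indicator {a<..<b} x * indicator {a<..<b} y" for x y :: real
  define H :: "real \<Rightarrow> real \<Rightarrow> ennreal"
    where "H x y = indicator {0<..<\<epsilon>} x * indicator {0<..<\<epsilon>} y" for x y
  define L where "L p = (\<integral>\<^sup>+x. \<integral>\<^sup>+y. H x y * k p (x - y) \<partial>lborel \<partial>lborel)" for p
  have [measurable]: "case_prod k \<in> borel_measurable (borel \<Otimes>\<^sub>M borel)"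
    unfolding k_def by measurable
  have [measurable]: "case_prod F \<in> borel_measurable (borel \<Otimes>\<^sub>M borel)"
    unfolding F_def by measurable
  have [measurable]: "case_prod H \<in> borel_measurable (borel \<Otimes>\<^sub>M borel)"
    unfolding H_def by measurable
  have [measurable]: "L \<in> borel_measurable borel"
    unfolding L_def by measurable
  have L: "L p = 2 * strip_kernel s \<epsilon> p" for p
  proof -
    have "L p = 2 * (\<integral>\<^sup>+z\<in>{0<..}. (\<integral>\<^sup>+x. H x (x + z) * k p (x - (x + z)) \<partial>lborel) \<partial>lborel)"
      unfolding L_def
    proof (rule nn_integral_symmetric_kernel)
      show "H x y * k p (x - y) = H y x * k p (y - x)" for x y
        by (simp add: H_def k_def power2_commute mult.commute)
    qed measurable
    also have "(\<integral>\<^sup>+z\<in>{0<..}. (\<integral>\<^sup>+x. H x (x + z) * k p (x - (x + z)) \<partial>lborel) \<partial>lborel)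
      = (\<integral>\<^sup>+z\<in>{0<..}. ennreal (\<epsilon> - z) * k p z \<partial>lborel)"
    proof (intro nn_integral_cong)
      fix z :: real
      have "(\<integral>\<^sup>+x. H x (x + z) * k p (x - (x + z)) \<partial>lborel) = ennreal (\<epsilon> - z) * k p z" if "0 < z"
      proof -
        \<comment> \<open>For \<open>z > 0\<close>, both \<open>x\<close> and \<open>x + z\<close>
          lie in the vertical interval exactly when \<open>0 < x < \<epsilon> - z\<close>; the
          kernel depends on \<open>x\<close> no longer, so the length of this interval is the
          weight.\<close>
        have "(\<integral>\<^sup>+x. H x (x + z) * k p (x - (x + z)) \<partial>lborel)
          = (\<integral>\<^sup>+x. k p z * indicator {0<..<\<epsilon> - z} x \<partial>lborel)"
          using that by (intro nn_integral_cong) (auto simp: H_def k_def split: split_indicator)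
        also have "\<dots> = k p z * ennreal (\<epsilon> - z)"
          by (cases "z \<le> \<epsilon>") (auto simp: nn_integral_cmult_indicator ennreal_neg)
        finally show ?thesis
          by (simp add: mult.commute)
      qed
      then show "(\<integral>\<^sup>+x. H x (x + z) * k p (x - (x + z)) \<partial>lborel) * indicator {0<..} z
        = ennreal (\<epsilon> - z) * k p z * indicator {0<..} z"
        by (auto split: split_indicator)
    qed
    finally show ?thesis
      by (simp add: strip_kernel_def k_def)
  qed
  have L_even: "L (- p) = L p" for p
    by (simp add: L_def k_def)
  have "gagliardo_sq s (thin_rect a b \<epsilon>) u
    = (\<integral>\<^sup>+x. \<integral>\<^sup>+y. F (fst x) (fst y) * H (snd x) (snd y) * k (fst x - fst y) (snd x - snd y) \<partial>lebesgue \<partial>lebesgue)"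
  proof -
    have *: "ennreal (\<bar>w (fst x) - w (fst y)\<bar>\<^sup>2 / norm (x - y) powr (2 + 2 * s)) * indicator (thin_rect a b \<epsilon>) y * indicator (thin_rect a b \<epsilon>) x
      = F (fst x) (fst y) * H (snd x) (snd y) * k (fst x - fst y) (snd x - snd y)" for x y
    proof -
      have "norm (x - y) powr (2 + 2 * s) = (norm (x - y) powr 2) powr (1 + s)"
        by (subst powr_powr) (simp add: algebra_simps)
      \<comment> \<open>The diagonal is treated apart: there both sides are 0, since
        \<open>0 powr 2 = 0\<close>.\<close>
      also have "norm (x - y) powr 2 = (fst x - fst y)\<^sup>2 + (snd x - snd y)\<^sup>2"
        by (cases "x = y") (auto simp: norm_prod_def powr_numeral)
      finally show ?thesis
        by (auto simp: F_def H_def k_def thin_rect_def mem_Times_iff ennreal_mult[symmetric] split: split_indicator)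
    qed
    show ?thesis
      unfolding gagliardo_sq_def
    \<comment> \<open>The a.e. identity for \<open>u\<close> is substituted in two rounds: first at
      the outer point \<open>x\<close>, then, with \<open>x\<close> fixed, at the inner point
      \<open>y\<close>.\<close>
    proof (rule nn_integral_cong_AE, rule eventually_mono[OF u])
      fix x :: "real \<times> real"
      assume x: "x \<in> thin_rect a b \<epsilon> \<longrightarrow> u x = w (fst x)"
      show "(\<integral>\<^sup>+y\<in>thin_rect a b \<epsilon>. ennreal (\<bar>u x - u y\<bar>\<^sup>2 / norm (x - y) powr (2 + 2 * s)) \<partial>lebesgue) * indicator (thin_rect a b \<epsilon>) x
        = (\<integral>\<^sup>+y. F (fst x) (fst y) * H (snd x) (snd y) * k (fst x - fst y) (snd x - snd y) \<partial>lebesgue)"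
      proof (cases "x \<in> thin_rect a b \<epsilon>")
        case True
        have "(\<integral>\<^sup>+y\<in>thin_rect a b \<epsilon>. ennreal (\<bar>u x - u y\<bar>\<^sup>2 / norm (x - y) powr (2 + 2 * s)) \<partial>lebesgue)
          = (\<integral>\<^sup>+y. F (fst x) (fst y) * H (snd x) (snd y) * k (fst x - fst y) (snd x - snd y) \<partial>lebesgue)"
          using x True
          by (intro nn_integral_cong_AE eventually_mono[OF u]) (auto simp: *[symmetric] split: split_indicator)
        then show ?thesis
          using True by simp
      next
        case False
        then have "F (fst x) (fst y) * H (snd x) (snd y) = 0" for y
          by (auto simp: F_def H_def thin_rect_def mem_Times_iff split: split_indicator)
        then show ?thesis
          using False by (simp del: mult_eq_0_iff)
      qed
    qed
  qed
  also have "\<dots> = (\<integral>\<^sup>+x. \<integral>\<^sup>+y. F (fst x) (fst y) * H (snd x) (snd y) * k (fst x - fst y) (snd x - snd y) \<partial>(lborel \<Otimes>\<^sub>M lborel) \<partial>(lborel \<Otimes>\<^sub>M lborel))"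
    by (simp add: nn_integral_completion lborel_prod)
  also have "\<dots> = (\<integral>\<^sup>+x1. \<integral>\<^sup>+x2. \<integral>\<^sup>+y1. \<integral>\<^sup>+y2. F x1 y1 * H x2 y2 * k (x1 - y1) (x2 - y2) \<partial>lborel \<partial>lborel \<partial>lborel \<partial>lborel)"
    by (simp add: lborel.nn_integral_fst[symmetric])
  \<comment> \<open>Exchanging \<open>x2\<close> and \<open>y1\<close> makes the two vertical
    integrals innermost, where they form \<open>L (x1 - y1)\<close>.\<close>
  also have "\<dots> = (\<integral>\<^sup>+x1. \<integral>\<^sup>+y1. \<integral>\<^sup>+x2. \<integral>\<^sup>+y2. F x1 y1 * H x2 y2 * k (x1 - y1) (x2 - y2) \<partial>lborel \<partial>lborel \<partial>lborel \<partial>lborel)"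
    by (intro nn_integral_cong lborel_pair.Fubini') measurable
  also have "\<dots> = (\<integral>\<^sup>+x1. \<integral>\<^sup>+y1. F x1 y1 * L (x1 - y1) \<partial>lborel \<partial>lborel)"
    by (simp add: L_def nn_integral_cmult[symmetric] mult.assoc)
  also have "\<dots> = 2 * (\<integral>\<^sup>+h\<in>{0<..}. (\<integral>\<^sup>+x. F x (x + h) * L (x - (x + h)) \<partial>lborel) \<partial>lborel)"
  proof (rule nn_integral_symmetric_kernel)
    show "F x y * L (x - y) = F y x * L (y - x)" for x y
      using L_even[of "x - y"] by (simp add: F_def mult.commute mult.left_commute power2_commute)
  qed measurable
  also have "\<dots> = 2 * (\<integral>\<^sup>+h\<in>{0<..}. \<Phi> h * L h \<partial>lborel)"
    by (simp add: L_even nn_integral_multc \<Phi>_def F_def)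
  also have "\<dots> = 2 * (\<integral>\<^sup>+h. 2 * (\<Phi> h * strip_kernel s \<epsilon> h * indicator {0<..} h) \<partial>lborel)"
    by (simp add: L mult.left_commute mult.assoc)
  also have "\<dots> = 4 * (\<integral>\<^sup>+h\<in>{0<..}. \<Phi> h * strip_kernel s \<epsilon> h \<partial>lborel)"
    unfolding \<Phi>_def by (subst nn_integral_cmult) (auto simp: mult.assoc[symmetric])
  finally show ?thesis .
qed

section \<open>Integrals of the kernel\<close>

text \<open>The numerator \<open>h\<close> makes the kernel an exact derivative, with primitive
  \<open>F\<close> below. Since \<open>z > 0\<close>, the base of the power stays positive down to
  \<open>h = 0\<close>.\<close>

lemma nn_integral_radial_kernel:
  fixes s m z :: real
  assumes "0 < s" "0 \<le> m" "0 < z"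
  shows "(\<integral>\<^sup>+h. ennreal (h / (h\<^sup>2 + z\<^sup>2) powr (1 + s)) * indicator {0..m} h \<partial>lborel)
    = ennreal ((z powr (- 2 * s) - (m\<^sup>2 + z\<^sup>2) powr (- s)) / (2 * s))"
proof -
  define F where "F h = - ((h\<^sup>2 + z\<^sup>2) powr (- s) / (2 * s))" for h :: real
  have "(\<integral>\<^sup>+h. ennreal (h / (h\<^sup>2 + z\<^sup>2) powr (1 + s)) * indicator {0..m} h \<partial>lborel) = ennreal (F m - F 0)"
  proof (rule nn_integral_FTC_Icc)
    fix h :: real
    have "0 < h\<^sup>2 + z\<^sup>2"
      using \<open>0 < z\<close> by (simp add: add_nonneg_pos)
    moreover have "- s - 1 = - (1 + s)"
      by simp
    then have "(h\<^sup>2 + z\<^sup>2) powr (- s - 1) = 1 / (h\<^sup>2 + z\<^sup>2) powr (1 + s)"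
      by (simp only: powr_minus_divide)
    ultimately show "(F has_real_derivative h / (h\<^sup>2 + z\<^sup>2) powr (1 + s)) (at h)"
      unfolding F_def using \<open>0 < s\<close> by (auto intro!: derivative_eq_intros simp: field_simps)
  qed (use assms in auto)
  also have "(z\<^sup>2) powr (- s) = z powr (- 2 * s)"
    using \<open>0 < z\<close> by (simp add: powr_powr flip: powr_numeral)
  then have "F m - F 0 = (z powr (- 2 * s) - (m\<^sup>2 + z\<^sup>2) powr (- s)) / (2 * s)"
    using \<open>0 < s\<close> by (simp add: F_def diff_divide_distrib)
  finally show ?thesis .
qed

lemma nn_integral_triangle:
  assumes "0 < \<epsilon>"
  shows "(\<integral>\<^sup>+z\<in>{0<..}. ennreal (\<epsilon> - z) \<partial>lborel) = ennreal (\<epsilon>\<^sup>2 / 2)"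
proof -
  have "(\<integral>\<^sup>+z\<in>{0<..}. ennreal (\<epsilon> - z) \<partial>lborel) = (\<integral>\<^sup>+z. ennreal (\<epsilon> - z) * indicator {0..\<epsilon>} z \<partial>lborel)"
    by (intro nn_integral_cong_AE eventually_mono[OF AE_lborel_singleton[of 0]])
      (auto simp: ennreal_neg split: split_indicator)
  also have "\<dots> = ennreal ((\<epsilon> * \<epsilon> - \<epsilon>\<^sup>2 / 2) - (\<epsilon> * 0 - 0\<^sup>2 / 2))"
    using assms
    by (intro nn_integral_FTC_Icc)
      (auto intro!: derivative_eq_intros)
  finally show ?thesis
    by (simp add: power2_eq_square)
qed

text \<open>The product expands into two powers of \<open>z\<close>. The bound on \<open>s\<close>
  makes both exponents of the primitive positive, so it is continuous at 0 with value 0; its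
  derivative may blow up there, which is why differentiability is used in the open interval
  only.\<close>

lemma nn_integral_triangle_powr:
  fixes s \<epsilon> :: real
  assumes "s < 1 / 2" "0 < \<epsilon>"
  shows "(\<integral>\<^sup>+z\<in>{0<..}. ennreal (\<epsilon> - z) * ennreal (z powr (- 2 * s)) \<partial>lborel)
    = ennreal (\<epsilon> powr (2 - 2 * s) / ((1 - 2 * s) * (2 - 2 * s)))"
proof -
  define F where "F z = \<epsilon> * z powr (1 - 2 * s) / (1 - 2 * s) - z powr (2 - 2 * s) / (2 - 2 * s)" for z
  have "((\<lambda>z. (\<epsilon> - z) * z powr (- 2 * s)) has_integral F \<epsilon> - F 0) {0..\<epsilon>}"
  proof (rule fundamental_theorem_of_calculus_interior)
    show "continuous_on {0..\<epsilon>} F"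
      unfolding F_def using \<open>s < 1 / 2\<close> by (auto intro!: continuous_on_diff continuous_on_divide continuous_on_mult continuous_on_powr' continuous_on_const continuous_on_id)
    fix z assume z: "z \<in> {0<..<\<epsilon>}"
    have *: "z powr (1 - 2 * s) = z * z powr (- 2 * s)"
      using z by (simp add: powr_diff powr_minus_divide)
    have "1 - 2 * s \<noteq> 0" "2 - 2 * s \<noteq> 0" "1 - 2 * s - 1 = - 2 * s" "2 - 2 * s - 1 = 1 - 2 * s"
      using \<open>s < 1 / 2\<close> by auto
    then have eq: "\<epsilon> * ((1 - 2 * s) * z powr (1 - 2 * s - 1)) / (1 - 2 * s) - (2 - 2 * s) * z powr (2 - 2 * s - 1) / (2 - 2 * s)
      = (\<epsilon> - z) * z powr (- 2 * s)"
      by (simp only: mult.left_commute[of \<epsilon>] nonzero_mult_div_cancel_left not_False_eq_True)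
        (simp only: * left_diff_distrib[of \<epsilon>])
    have powr: "((\<lambda>z. z powr r) has_real_derivative r * z powr (r - 1)) (at z)" for r
      using z by (intro has_real_derivative_powr) auto
    have "(F has_real_derivative (\<epsilon> - z) * z powr (- 2 * s)) (at z)"
      unfolding F_def eq[symmetric] by (intro DERIV_diff DERIV_cdivide DERIV_cmult powr)
    then show "(F has_vector_derivative (\<epsilon> - z) * z powr (- 2 * s)) (at z)"
      by (simp add: has_real_derivative_iff_has_vector_derivative[symmetric])
  qed (use assms in auto)
  then have "(\<integral>\<^sup>+z. ennreal ((\<epsilon> - z) * z powr (- 2 * s)) * indicator {0..\<epsilon>} z \<partial>lborel) = ennreal (F \<epsilon> - F 0)"
    by (intro nn_integral_has_integral_lebesgue') auto
  also have "(\<integral>\<^sup>+z. ennreal ((\<epsilon> - z) * z powr (- 2 * s)) * indicator {0..\<epsilon>} z \<partial>lborel)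
    = (\<integral>\<^sup>+z\<in>{0<..}. ennreal (\<epsilon> - z) * ennreal (z powr (- 2 * s)) \<partial>lborel)"
    by (intro nn_integral_cong_AE eventually_mono[OF AE_lborel_singleton[of 0]])
      (auto simp: ennreal_neg ennreal_mult split: split_indicator)
  also have "F \<epsilon> - F 0 = \<epsilon> powr (2 - 2 * s) / ((1 - 2 * s) * (2 - 2 * s))"
  proof -
    have "\<epsilon> * \<epsilon> powr (1 - 2 * s) = \<epsilon> powr (2 - 2 * s)"
      using \<open>0 < \<epsilon>\<close> by (simp add: powr_diff power2_eq_square powr_numeral)
    then have "F \<epsilon> - F 0 = \<epsilon> powr (2 - 2 * s) * (1 / (1 - 2 * s) - 1 / (2 - 2 * s))"
      by (simp add: F_def right_diff_distrib)
    also have "1 / (1 - 2 * s) - 1 / (2 - 2 * s) = 1 / ((1 - 2 * s) * (2 - 2 * s))"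
      using \<open>s < 1 / 2\<close> by (subst diff_frac_eq) auto
    finally show ?thesis
      by simp
  qed
  finally show ?thesis .
qed

section \<open>Near and far contributions of the strip kernel\<close>

context
  fixes s m \<epsilon> :: real
  assumes s: "0 < s" "s < 1 / 2" and m: "0 < m" and \<epsilon>: "0 < \<epsilon>"
begin

text \<open>Away from \<open>h = 0\<close> the kernel is bounded, and only the mass of the
  triangular weight remains. Compared with \<open>\<epsilon> powr (2 - 2 * s) / s\<close> this bound
  carries an extra factor \<open>s\<close>, which makes the far part negligible.\<close>

lemma strip_kernel_far:
  assumes "m \<le> h"
  shows "strip_kernel s \<epsilon> h \<le> ennreal (\<epsilon>\<^sup>2 / 2 * m powr (- 2 - 2 * s))"
proof -
  have *: "1 / (h\<^sup>2 + z\<^sup>2) powr (1 + s) \<le> m powr (- 2 - 2 * s)" for z :: real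
  proof -
    have "m\<^sup>2 \<le> h\<^sup>2 + z\<^sup>2"
      using power_mono[OF assms, of 2] m by (simp add: add_increasing2)
    then have "(m\<^sup>2) powr (1 + s) \<le> (h\<^sup>2 + z\<^sup>2) powr (1 + s)"
      using s by (intro powr_mono2) auto
    moreover have "(m\<^sup>2) powr (1 + s) = m powr (2 + 2 * s)"
      using m by (simp add: powr_powr algebra_simps flip: powr_numeral)
    moreover have "m powr (- 2 - 2 * s) = 1 / m powr (2 + 2 * s)"
      by (simp add: powr_minus_divide[symmetric])
    ultimately show ?thesis
      using m by (simp add: frac_le)
  qed
  have "strip_kernel s \<epsilon> h \<le> (\<integral>\<^sup>+z. ennreal (\<epsilon> - z) * indicator {0<..} z * ennreal (m powr (- 2 - 2 * s)) \<partial>lborel)"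
    unfolding strip_kernel_def
    by (intro nn_integral_mono) (auto split: split_indicator intro!: mult_left_mono ennreal_leI *)
  also have "\<dots> = ennreal (\<epsilon>\<^sup>2 / 2) * ennreal (m powr (- 2 - 2 * s))"
    by (subst nn_integral_multc) (auto simp: nn_integral_triangle[OF \<epsilon>])
  finally show ?thesis
    by (subst ennreal_mult) auto
qed

text \<open>Tonelli lets the integral over \<open>h\<close> be taken first, where the radial
  primitive is explicit. The weight \<open>h\<close> is, up to a constant, the increment energy of a
  step function at small shifts.\<close>

lemma nn_integral_strip_kernel_near:
  "(\<integral>\<^sup>+h\<in>{0<..<m}. ennreal h * strip_kernel s \<epsilon> h \<partial>lborel)
    = (\<integral>\<^sup>+z\<in>{0<..}. ennreal (\<epsilon> - z) * ennreal ((z powr (- 2 * s) - (m\<^sup>2 + z\<^sup>2) powr (- s)) / (2 * s)) \<partial>lborel)"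
proof -
  have "(\<integral>\<^sup>+h\<in>{0<..<m}. ennreal h * strip_kernel s \<epsilon> h \<partial>lborel)
    = (\<integral>\<^sup>+h. \<integral>\<^sup>+z. ennreal h * indicator {0<..<m} h * (ennreal (\<epsilon> - z) * ennreal (1 / (h\<^sup>2 + z\<^sup>2) powr (1 + s)) * indicator {0<..} z) \<partial>lborel \<partial>lborel)"
    unfolding strip_kernel_def by (subst nn_integral_cmult) (auto simp: mult_ac intro!: nn_integral_cong)
  also have "\<dots> = (\<integral>\<^sup>+z. \<integral>\<^sup>+h. ennreal h * indicator {0<..<m} h * (ennreal (\<epsilon> - z) * ennreal (1 / (h\<^sup>2 + z\<^sup>2) powr (1 + s)) * indicator {0<..} z) \<partial>lborel \<partial>lborel)"
    by (rule lborel_pair.Fubini'[symmetric]) measurable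
  also have "\<dots> = (\<integral>\<^sup>+z\<in>{0<..}. ennreal (\<epsilon> - z) * (\<integral>\<^sup>+h. ennreal (h / (h\<^sup>2 + z\<^sup>2) powr (1 + s)) * indicator {0..m} h \<partial>lborel) \<partial>lborel)"
  proof (intro nn_integral_cong)
    fix z :: real
    have "(\<integral>\<^sup>+h. ennreal h * indicator {0<..<m} h * (ennreal (\<epsilon> - z) * ennreal (1 / (h\<^sup>2 + z\<^sup>2) powr (1 + s)) * indicator {0<..} z) \<partial>lborel)
      = (\<integral>\<^sup>+h. ennreal (\<epsilon> - z) * indicator {0<..} z * (ennreal (h / (h\<^sup>2 + z\<^sup>2) powr (1 + s)) * indicator {0..m} h) \<partial>lborel)"
      by (intro nn_integral_cong_AE eventually_mono[OF eventually_conj[OF AE_lborel_singleton[of 0] AE_lborel_singleton[of m]]])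
        (auto split: split_indicator simp: ennreal_mult mult_ac divide_inverse)
    also have "\<dots> = ennreal (\<epsilon> - z) * indicator {0<..} z * (\<integral>\<^sup>+h. ennreal (h / (h\<^sup>2 + z\<^sup>2) powr (1 + s)) * indicator {0..m} h \<partial>lborel)"
      by (rule nn_integral_cmult) measurable
    finally show "(\<integral>\<^sup>+h. ennreal h * indicator {0<..<m} h * (ennreal (\<epsilon> - z) * ennreal (1 / (h\<^sup>2 + z\<^sup>2) powr (1 + s)) * indicator {0<..} z) \<partial>lborel)
      = ennreal (\<epsilon> - z) * (\<integral>\<^sup>+h. ennreal (h / (h\<^sup>2 + z\<^sup>2) powr (1 + s)) * indicator {0..m} h \<partial>lborel) * indicator {0<..} z"
      by (simp add: mult_ac)
  qed
  also have "\<dots> = (\<integral>\<^sup>+z\<in>{0<..}. ennreal (\<epsilon> - z) * ennreal ((z powr (- 2 * s) - (m\<^sup>2 + z\<^sup>2) powr (- s)) / (2 * s)) \<partial>lborel)"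
    using s m by (intro nn_integral_cong) (auto simp: nn_integral_radial_kernel split: split_indicator)
  finally show ?thesis .
qed

text \<open>For \<open>0 < z < \<epsilon>\<close> the integrand is minimised by putting
  \<open>z = \<epsilon>\<close> in the first power and \<open>z = 0\<close> in the second, and the
  weight has mass \<open>\<epsilon>\<^sup>2 / 2\<close>. The assumption
  \<open>\<epsilon> \<le> m\<close> makes the resulting constant \<open>D\<close> nonnegative, so
  \<open>ennreal\<close> does not truncate it.\<close>

lemma strip_kernel_near_lower:
  assumes "\<epsilon> \<le> m"
  shows "ennreal (\<epsilon>\<^sup>2 / 2 * ((\<epsilon> powr (- 2 * s) - m powr (- 2 * s)) / (2 * s)))
    \<le> (\<integral>\<^sup>+h\<in>{0<..<m}. ennreal h * strip_kernel s \<epsilon> h \<partial>lborel)"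
proof -
  define D where "D = (\<epsilon> powr (- 2 * s) - m powr (- 2 * s)) / (2 * s)"
  have "m powr (- 2 * s) \<le> \<epsilon> powr (- 2 * s)"
    using s \<epsilon> assms by (intro powr_mono2') auto
  then have "0 \<le> D"
    using s by (simp add: D_def)
  have D: "D \<le> (z powr (- 2 * s) - (m\<^sup>2 + z\<^sup>2) powr (- s)) / (2 * s)" if "0 < z" "z < \<epsilon>" for z
  proof -
    have "\<epsilon> powr (- 2 * s) \<le> z powr (- 2 * s)"
      using that s by (intro powr_mono2') auto
    moreover have "(m\<^sup>2 + z\<^sup>2) powr (- s) \<le> (m\<^sup>2) powr (- s)"
      using m s by (intro powr_mono2') auto
    moreover have "(m\<^sup>2) powr (- s) = m powr (- 2 * s)"
      using m by (simp add: powr_powr flip: powr_numeral)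
    ultimately show ?thesis
      using s by (auto simp: D_def intro!: divide_right_mono)
  qed
  have "ennreal (\<epsilon>\<^sup>2 / 2 * D) = (\<integral>\<^sup>+z. ennreal (\<epsilon> - z) * indicator {0<..} z * ennreal D \<partial>lborel)"
    using \<open>0 \<le> D\<close>
    by (subst nn_integral_multc, simp, subst ennreal_mult) (auto simp: nn_integral_triangle[OF \<epsilon>])
  also have "\<dots> \<le> (\<integral>\<^sup>+z\<in>{0<..}. ennreal (\<epsilon> - z) * ennreal ((z powr (- 2 * s) - (m\<^sup>2 + z\<^sup>2) powr (- s)) / (2 * s)) \<partial>lborel)"
  proof (intro nn_integral_mono)
    fix z :: real
    show "ennreal (\<epsilon> - z) * indicator {0<..} z * ennreal D
      \<le> ennreal (\<epsilon> - z) * ennreal ((z powr (- 2 * s) - (m\<^sup>2 + z\<^sup>2) powr (- s)) / (2 * s)) * indicator {0<..} z"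
      using D[of z] by (cases "z < \<epsilon>") (auto simp: ennreal_neg split: split_indicator intro!: mult_left_mono ennreal_leI)
  qed
  finally show ?thesis
    by (simp add: nn_integral_strip_kernel_near D_def)
qed

text \<open>The first power is unbounded near \<open>z = 0\<close> and is therefore integrated
  exactly; the subtracted power is smallest at \<open>z = \<epsilon>\<close> and is replaced by that
  value.\<close>

lemma strip_kernel_near_upper:
  "(\<integral>\<^sup>+h\<in>{0<..<m}. ennreal h * strip_kernel s \<epsilon> h \<partial>lborel)
    \<le> ennreal ((\<epsilon> powr (2 - 2 * s) / ((1 - 2 * s) * (2 - 2 * s)) - \<epsilon>\<^sup>2 / 2 * (m\<^sup>2 + \<epsilon>\<^sup>2) powr (- s)) / (2 * s))"
    (is "?I \<le> _")
proof -
  define D where "D = (m\<^sup>2 + \<epsilon>\<^sup>2) powr (- s) / (2 * s)"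
  have "0 \<le> D"
    using s by (simp add: D_def)
  have D: "ennreal ((z powr (- 2 * s) - (m\<^sup>2 + z\<^sup>2) powr (- s)) / (2 * s)) + ennreal D
    \<le> ennreal (z powr (- 2 * s)) * ennreal (1 / (2 * s))" if "0 < z" "z < \<epsilon>" for z
  proof -
    have "(m\<^sup>2 + \<epsilon>\<^sup>2) powr (- s) \<le> (m\<^sup>2 + z\<^sup>2) powr (- s)"
      using m s that by (intro powr_mono2') (auto intro!: power_mono simp: add_pos_nonneg)
    moreover have "(m\<^sup>2 + z\<^sup>2) powr (- s) \<le> (z\<^sup>2) powr (- s)"
      using that s by (intro powr_mono2') auto
    moreover have "(z\<^sup>2) powr (- s) = z powr (- 2 * s)"
      using that by (simp add: powr_powr flip: powr_numeral)
    ultimately show ?thesis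
      using s \<open>0 \<le> D\<close>
      by (simp add: D_def ennreal_plus[symmetric] ennreal_mult[symmetric] add_divide_distrib[symmetric]
          del: ennreal_plus) (auto intro!: ennreal_leI divide_right_mono)
  qed
  have *: "ennreal (\<epsilon>\<^sup>2 / 2 * D) = ennreal (\<epsilon>\<^sup>2 / 2) * ennreal D"
    using \<open>0 \<le> D\<close> by (subst ennreal_mult) auto
  \<comment> \<open>Subtraction in \<open>ennreal\<close> truncates, so the negative term is first
    added on the left, as in the pointwise bound \<open>D\<close>, and moved back only at the
    end.\<close>
  have "?I + ennreal (\<epsilon>\<^sup>2 / 2 * D)
    = (\<integral>\<^sup>+z\<in>{0<..}. ennreal (\<epsilon> - z) * ennreal ((z powr (- 2 * s) - (m\<^sup>2 + z\<^sup>2) powr (- s)) / (2 * s)) \<partial>lborel)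
      + (\<integral>\<^sup>+z. ennreal (\<epsilon> - z) * indicator {0<..} z * ennreal D \<partial>lborel)"
    unfolding * by (subst nn_integral_multc) (auto simp: nn_integral_triangle[OF \<epsilon>] nn_integral_strip_kernel_near)
  also have "\<dots> = (\<integral>\<^sup>+z. ennreal (\<epsilon> - z) * ennreal ((z powr (- 2 * s) - (m\<^sup>2 + z\<^sup>2) powr (- s)) / (2 * s)) * indicator {0<..} z
      + ennreal (\<epsilon> - z) * indicator {0<..} z * ennreal D \<partial>lborel)"
    by (rule nn_integral_add[symmetric]) measurable
  also have "\<dots> \<le> (\<integral>\<^sup>+z. ennreal (\<epsilon> - z) * ennreal (z powr (- 2 * s)) * indicator {0<..} z * ennreal (1 / (2 * s)) \<partial>lborel)"
  proof (intro nn_integral_mono)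
    fix z :: real
    show "ennreal (\<epsilon> - z) * ennreal ((z powr (- 2 * s) - (m\<^sup>2 + z\<^sup>2) powr (- s)) / (2 * s)) * indicator {0<..} z
      + ennreal (\<epsilon> - z) * indicator {0<..} z * ennreal D
      \<le> ennreal (\<epsilon> - z) * ennreal (z powr (- 2 * s)) * indicator {0<..} z * ennreal (1 / (2 * s))"
    proof (cases "0 < z \<and> z < \<epsilon>")
      case True
      then show ?thesis
        using mult_left_mono[OF D, of z "ennreal (\<epsilon> - z)"] by (simp add: distrib_left mult.assoc)
    qed (auto simp: ennreal_neg split: split_indicator)
  qed
  also have "\<dots> = ennreal (\<epsilon> powr (2 - 2 * s) / ((1 - 2 * s) * (2 - 2 * s))) * ennreal (1 / (2 * s))"
    using s \<epsilon> by (subst nn_integral_multc) (auto simp: nn_integral_triangle_powr[simplified])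
  also have "\<dots> = ennreal (\<epsilon> powr (2 - 2 * s) / ((1 - 2 * s) * (2 - 2 * s)) / (2 * s))"
    using s by (subst ennreal_mult[symmetric]) auto
  finally have "?I + ennreal (\<epsilon>\<^sup>2 / 2 * D) \<le> ennreal (\<epsilon> powr (2 - 2 * s) / ((1 - 2 * s) * (2 - 2 * s)) / (2 * s))" .
  then have "?I \<le> ennreal (\<epsilon> powr (2 - 2 * s) / ((1 - 2 * s) * (2 - 2 * s)) / (2 * s)) - ennreal (\<epsilon>\<^sup>2 / 2 * D)"
    by (simp add: ennreal_le_minus_iff)
  also have "\<dots> = ennreal (\<epsilon> powr (2 - 2 * s) / ((1 - 2 * s) * (2 - 2 * s)) / (2 * s) - \<epsilon>\<^sup>2 / 2 * D)"
    using \<open>0 \<le> D\<close> by (intro ennreal_minus) auto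
  finally show ?thesis
    by (simp add: D_def diff_divide_distrib)
qed

text \<open>Needed later to split \<open>ennreal\<close> of a sum. Dropping \<open>m\<close> bounds
  the subtracted term by \<open>\<epsilon> powr (2 - 2 * s) / 2\<close>, and
  \<open>(1 - 2 * s) * (2 - 2 * s) \<le> 2\<close>.\<close>

lemma strip_kernel_near_upper_nonneg:
  "0 \<le> \<epsilon> powr (2 - 2 * s) / ((1 - 2 * s) * (2 - 2 * s)) - \<epsilon>\<^sup>2 / 2 * (m\<^sup>2 + \<epsilon>\<^sup>2) powr (- s)"
proof -
  have "(m\<^sup>2 + \<epsilon>\<^sup>2) powr (- s) \<le> (\<epsilon>\<^sup>2) powr (- s)"
    using s \<epsilon> by (intro powr_mono2') auto
  then have "\<epsilon>\<^sup>2 / 2 * (m\<^sup>2 + \<epsilon>\<^sup>2) powr (- s) \<le> \<epsilon>\<^sup>2 / 2 * (\<epsilon>\<^sup>2) powr (- s)"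
    by (intro mult_left_mono) auto
  also have "\<dots> = \<epsilon> powr (2 - 2 * s) / 2"
    using \<epsilon> by (simp add: powr_powr powr_add[symmetric] flip: powr_numeral)
  also have "\<dots> \<le> \<epsilon> powr (2 - 2 * s) / ((1 - 2 * s) * (2 - 2 * s))"
    using s mult_mono[of "1 - 2 * s" 1 "2 - 2 * s" 2] by (intro divide_left_mono) auto
  finally show ?thesis
    by simp
qed

end

section \<open>Essential one-sided limits\<close>

text \<open>An interval to the right of \<open>t\<close> has positive measure, so it meets every set
  of full measure. Properness of the filter yields uniqueness of essential limits and lets
  \<open>Lim\<close> be evaluated.\<close>

lemma ess_at_right_neq_bot: "ess_at_right t \<noteq> bot"
proof
  assume "ess_at_right t = bot"
  then have "eventually (\<lambda>x. False) (ess_at_right t)"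
    by simp
  then obtain Q R where Q: "eventually Q (at_right t)" and R: "AE x in lebesgue. R x"
    and QR: "\<And>x. Q x \<Longrightarrow> R x \<Longrightarrow> False"
    unfolding ess_at_right_def eventually_inf by blast
  from Q obtain r where r: "t < r" "\<And>x. t < x \<Longrightarrow> x < r \<Longrightarrow> Q x"
    unfolding eventually_at_right_field by auto
  have "AE x in lborel. x \<notin> {t<..<r}"
    using R unfolding AE_completion_iff by eventually_elim (use r QR in auto)
  then have "emeasure lborel {t<..<r} = 0"
    by (subst (asm) AE_iff_null_sets[symmetric]) auto
  then show False
    using r(1) by simp
qed

lemma ess_at_left_neq_bot: "ess_at_left t \<noteq> bot"
proof
  assume "ess_at_left t = bot"
  then have "eventually (\<lambda>x. False) (ess_at_left t)"
    by simp
  then obtain Q R where Q: "eventually Q (at_left t)" and R: "AE x in lebesgue. R x"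
    and QR: "\<And>x. Q x \<Longrightarrow> R x \<Longrightarrow> False"
    unfolding ess_at_left_def eventually_inf by blast
  from Q obtain r where r: "r < t" "\<And>x. r < x \<Longrightarrow> x < t \<Longrightarrow> Q x"
    unfolding eventually_at_left_field by auto
  have "AE x in lborel. x \<notin> {r<..<t}"
    using R unfolding AE_completion_iff by eventually_elim (use r QR in auto)
  then have "emeasure lborel {r<..<t} = 0"
    by (subst (asm) AE_iff_null_sets[symmetric]) auto
  then show False
    using r(1) by simp
qed

lemma ess_at_right_tendstoI:
  assumes "t < r" and "AE x in lebesgue. t < x \<and> x < r \<longrightarrow> v x = l"
  shows "(v \<longlongrightarrow> l) (ess_at_right t)"
proof (rule tendsto_eventually)
  have "eventually (\<lambda>x. t < x \<and> x < r) (at_right t)"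
    using \<open>t < r\<close> by (auto simp: eventually_at_right_field)
  with assms(2) show "eventually (\<lambda>x. v x = l) (ess_at_right t)"
    unfolding ess_at_right_def eventually_inf by blast
qed

lemma ess_at_left_tendstoI:
  assumes "r < t" and "AE x in lebesgue. r < x \<and> x < t \<longrightarrow> v x = l"
  shows "(v \<longlongrightarrow> l) (ess_at_left t)"
proof (rule tendsto_eventually)
  have "eventually (\<lambda>x. r < x \<and> x < t) (at_left t)"
    using \<open>r < t\<close> by (auto simp: eventually_at_left_field)
  with assms(2) show "eventually (\<lambda>x. v x = l) (ess_at_left t)"
    unfolding ess_at_left_def eventually_inf by blast
qed

text \<open>By uniqueness of essential limits, the limits quantified in \<open>jump_set\<close> can
  only be the given \<open>l\<close> and \<open>r\<close>.\<close>

lemma jump_set_iff: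
  assumes "(v \<longlongrightarrow> l) (ess_at_left t)" "(v \<longlongrightarrow> r) (ess_at_right t)" "t \<in> {a<..<b}"
  shows "t \<in> jump_set a b v \<longleftrightarrow> l \<noteq> r"
  using assms tendsto_unique[OF ess_at_left_neq_bot[of t]] tendsto_unique[OF ess_at_right_neq_bot[of t]]
  unfolding jump_set_def by blast

section \<open>Step functions\<close>

locale interval_partition =
  fixes a b :: real and N :: nat and p c :: "nat \<Rightarrow> real"
  assumes p_0: "p 0 = a" and p_last: "p (N + 1) = b" and p_step: "i \<le> N \<Longrightarrow> p i < p (i + 1)"
begin

definition step :: "real \<Rightarrow> real"
  where "step x = (\<Sum>j=1..N+1. c j * indicator {p (j - 1)<..<p j} x)"

text \<open>All interior partition points are summed over. Neighbouring values \<open>c j\<close>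
  and \<open>c (j + 1)\<close> may coincide; such a point is no jump and contributes 0.\<close>

definition jump_energy :: real
  where "jump_energy = (\<Sum>j=1..N. (c j - c (j + 1))\<^sup>2)"

lemma jump_energy_nonneg: "0 \<le> jump_energy"
  unfolding jump_energy_def by (intro sum_nonneg) auto

lemma p_less: "i < j \<Longrightarrow> j \<le> N + 1 \<Longrightarrow> p i < p j"
proof (induction j)
  case (Suc j)
  then show ?case
    using p_step[of j] by (cases "i = j") auto
qed simp

lemma p_le: "i \<le> j \<Longrightarrow> j \<le> N + 1 \<Longrightarrow> p i \<le> p j"
  using p_less[of i j] by (cases "i = j") auto

lemma p_in_interval: "1 \<le> j \<Longrightarrow> j \<le> N \<Longrightarrow> a < p j \<and> p j < b"
  using p_less[of 0 j] p_less[of j "N + 1"] p_0 p_last by auto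

lemma inj_on_p: "inj_on p {..N + 1}"
  by (rule inj_onI, rule ccontr) (metis atMost_iff less_irrefl linorder_neqE_nat p_less)

lemma step_eq:
  assumes j: "1 \<le> j" "j \<le> N + 1" and x: "p (j - 1) < x" "x < p j"
  shows "step x = c j"
proof -
  have "x \<notin> {p (i - 1)<..<p i}" if "i \<in> {1..N+1} - {j}" for i
  proof (cases "i < j")
    case True
    then have "p i \<le> p (j - 1)"
      using j by (intro p_le) auto
    then show ?thesis
      using x by auto
  next
    case False
    then have "p j \<le> p (i - 1)"
      using that by (intro p_le) auto
    then show ?thesis
      using x by auto
  qed
  then have "step x = (\<Sum>i=1..N+1. if i = j then c j else 0)"
    unfolding step_def using x by (intro sum.cong) auto
  then show ?thesis
    using j by simp
qed

text \<open>The right end of the cell is the first partition point beyond \<open>x\<close>.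
  Minimality puts the preceding point at or below \<open>x\<close>, strictly so because
  \<open>x\<close> is no partition point.\<close>

lemma obtain_cell:
  assumes "a < x" "x < b" "x \<notin> p ` {..N + 1}"
  obtains j where "1 \<le> j" "j \<le> N + 1" "p (j - 1) < x" "x < p j"
proof -
  define j where "j = (LEAST j. x < p j)"
  have last: "x < p (N + 1)"
    using assms p_last by simp
  then have "x < p j"
    unfolding j_def by (rule LeastI)
  have "j \<le> N + 1"
    unfolding j_def using last by (rule Least_le)
  have "j \<noteq> 0"
    using \<open>x < p j\<close> assms p_0 by (intro notI) auto
  then have "\<not> x < p (j - 1)"
    unfolding j_def by (intro not_less_Least) auto
  moreover have "x \<noteq> p (j - 1)"
    using assms(3) \<open>j \<le> N + 1\<close> by auto
  ultimately show ?thesis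
    using that[of j] \<open>x < p j\<close> \<open>j \<le> N + 1\<close> \<open>j \<noteq> 0\<close> by simp
qed

lemma step_measurable [measurable]: "step \<in> borel_measurable borel"
  unfolding step_def by measurable

text \<open>At \<open>p j\<close> the essential limits of \<open>v\<close> are \<open>c j\<close>
  and \<open>c (j + 1)\<close>, and inside a cell they agree. So the jumps are the interior
  partition points with distinct neighbouring values, and injectivity of \<open>p\<close> turns the
  sum over points into one over indices.\<close>

lemma sum_jump_set:
  assumes v: "AE x in lebesgue. x \<in> {a<..<b} \<longrightarrow> v x = step x"
  shows "(\<Sum>t\<in>jump_set a b v. \<bar>right_lim v t - left_lim v t\<bar>\<^sup>2) = jump_energy"
proof -
  have cell: "AE x in lebesgue. p (j - 1) < x \<and> x < p j \<longrightarrow> v x = c j" if "1 \<le> j" "j \<le> N + 1" for j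
    using v
  proof eventually_elim
    case (elim x)
    moreover have "a \<le> p (j - 1)" "p j \<le> b"
      using p_le[of 0 "j - 1"] p_le[of j "N + 1"] that p_0 p_last by auto
    ultimately show ?case
      using step_eq[OF that, of x] by auto
  qed
  have right: "(v \<longlongrightarrow> c j) (ess_at_right t)" if "1 \<le> j" "j \<le> N + 1" "p (j - 1) \<le> t" "t < p j" for j t
    using that by (intro ess_at_right_tendstoI[of t "p j"] eventually_mono[OF cell[of j]]) auto
  have left: "(v \<longlongrightarrow> c j) (ess_at_left t)" if "1 \<le> j" "j \<le> N + 1" "p (j - 1) < t" "t \<le> p j" for j t
    using that by (intro ess_at_left_tendstoI[of "p (j - 1)" t] eventually_mono[OF cell[of j]]) auto
  have left_p: "(v \<longlongrightarrow> c j) (ess_at_left (p j))" and right_p: "(v \<longlongrightarrow> c (j + 1)) (ess_at_right (p j))"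
    if "j \<in> {1..N}" for j
    using that left[of j "p j"] right[of "j + 1" "p j"] p_less[of "j - 1" j] p_less[of j "j + 1"] by auto
  have jump_p: "p j \<in> jump_set a b v \<longleftrightarrow> c j \<noteq> c (j + 1)" if "j \<in> {1..N}" for j
    using jump_set_iff[OF left_p[OF that] right_p[OF that]] p_in_interval[of j] that by auto
  have "jump_set a b v = p ` {j \<in> {1..N}. c j \<noteq> c (j + 1)}"
  proof (intro equalityI subsetI)
    fix t assume t: "t \<in> jump_set a b v"
    then have ab: "a < t" "t < b"
      by (auto simp: jump_set_def)
    have "t \<in> p ` {..N + 1}"
    proof (rule ccontr)
      assume "t \<notin> p ` {..N + 1}"
      then obtain j where j: "1 \<le> j" "j \<le> N + 1" "p (j - 1) < t" "t < p j"
        using obtain_cell ab by blast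
      then show False
        using jump_set_iff[OF left[of j t] right[of j t], of a b] t ab by auto
    qed
    then obtain j where j: "t = p j" "j \<le> N + 1"
      by auto
    \<comment> \<open>The extreme indices would give \<open>t = a\<close> or \<open>t = b\<close>,
      outside the open interval.\<close>
    then have "j \<noteq> 0" "j \<noteq> N + 1"
      using ab p_0 p_last by (metis less_irrefl)+
    then have "j \<in> {1..N}"
      using j by auto
    then show "t \<in> p ` {j \<in> {1..N}. c j \<noteq> c (j + 1)}"
      using t j jump_p by auto
  qed (use jump_p in auto)
  then have "(\<Sum>t\<in>jump_set a b v. \<bar>right_lim v t - left_lim v t\<bar>\<^sup>2)
    = (\<Sum>j | j \<in> {1..N} \<and> c j \<noteq> c (j + 1). \<bar>right_lim v (p j) - left_lim v (p j)\<bar>\<^sup>2)"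
    by (simp only:) (subst sum.reindex, auto intro: inj_on_subset[OF inj_on_p])
  also have "\<dots> = (\<Sum>j | j \<in> {1..N} \<and> c j \<noteq> c (j + 1). (c j - c (j + 1))\<^sup>2)"
  proof (intro sum.cong refl)
    fix j assume "j \<in> {j. j \<in> {1..N} \<and> c j \<noteq> c (j + 1)}"
    then show "\<bar>right_lim v (p j) - left_lim v (p j)\<bar>\<^sup>2 = (c j - c (j + 1))\<^sup>2"
      using tendsto_Lim[OF ess_at_left_neq_bot left_p[of j]] tendsto_Lim[OF ess_at_right_neq_bot right_p[of j]]
      by (simp add: right_lim_def left_lim_def power2_commute)
  qed
  also have "\<dots> = jump_energy"
    unfolding jump_energy_def by (intro sum.mono_neutral_left) auto
  finally show ?thesis .
qed

section \<open>The increment energy \<open>\<Phi>\<close> of a step function\<close>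

definition shift_energy :: "real \<Rightarrow> ennreal"
  where "shift_energy h = (\<integral>\<^sup>+x. ennreal ((step x - step (x + h))\<^sup>2) * indicator {a<..<b} x * indicator {a<..<b} (x + h) \<partial>lborel)"

lemma shift_energy_measurable [measurable]: "shift_energy \<in> borel_measurable borel"
  unfolding shift_energy_def by measurable

lemma shift_energy_far:
  assumes "b - a \<le> h"
  shows "shift_energy h = 0"
proof -
  have *: "indicator {a<..<b} x * indicator {a<..<b} (x + h) = (0::ennreal)" for x
    using assms by (auto split: split_indicator)
  show ?thesis
    unfolding shift_energy_def by (simp add: mult.assoc *)
qed

text \<open>Values of \<open>step\<close> are bounded by the sum of all
  \<open>\<bar>c j\<bar>\<close>, and \<open>x\<close> ranges over a set of length at most
  \<open>b - a\<close>. A crude bound suffices, as it only multiplies the negligible far part of the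
  kernel.\<close>

lemma shift_energy_bounded:
  assumes "a \<le> b"
  shows "shift_energy h \<le> ennreal ((2 * (\<Sum>j=1..N+1. \<bar>c j\<bar>))\<^sup>2 * (b - a))"
proof -
  define W where "W = (\<Sum>j=1..N+1. \<bar>c j\<bar>)"
  have W: "\<bar>step x\<bar> \<le> W" for x
    unfolding step_def W_def
    by (rule order_trans[OF sum_abs], rule sum_mono) (simp split: split_indicator)
  have "(step x - step y)\<^sup>2 \<le> (2 * W)\<^sup>2" for x y
    using W[of x] W[of y] by (intro abs_le_square_iff[THEN iffD1]) auto
  then have "shift_energy h \<le> (\<integral>\<^sup>+x. ennreal ((2 * W)\<^sup>2) * indicator {a<..<b} x \<partial>lborel)"
    unfolding shift_energy_def
    by (intro nn_integral_mono) (auto split: split_indicator intro!: ennreal_leI)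
  also have "\<dots> = ennreal ((2 * W)\<^sup>2 * (b - a))"
    using assms by (subst ennreal_mult) (auto simp: nn_integral_cmult_indicator)
  finally show ?thesis
    by (simp add: W_def)
qed

text \<open>A shift shorter than every cell crosses at most one partition point. It crosses
  \<open>p j\<close> precisely for \<open>x\<close> in \<open>?J j\<close>, an interval of length
  \<open>h\<close>, up to a null set.\<close>

lemma shift_energy_near:
  assumes m: "\<And>i. i \<le> N \<Longrightarrow> m \<le> p (i + 1) - p i" and h: "0 < h" "h < m"
  shows "shift_energy h = ennreal (jump_energy * h)"
proof -
  let ?J = "\<lambda>j. {p j - h<..<p j}"
  \<comment> \<open>The finite set where \<open>x\<close> or \<open>x + h\<close> is a partition
    point; \<open>step\<close> takes the value 0 there instead of a neighbouring cell value.\<close>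
  let ?E = "p ` {..N + 1} \<union> (\<lambda>y. y - h) ` p ` {..N + 1}"
  have near: "p i + h < p (i + 1)" if "i \<le> N" for i
    using m[OF that] h by auto
  have pointwise: "ennreal ((step x - step (x + h))\<^sup>2) * indicator {a<..<b} x * indicator {a<..<b} (x + h)
    = (\<Sum>j=1..N. ennreal ((c j - c (j + 1))\<^sup>2) * indicator (?J j) x)" if "x \<notin> ?E" for x
  proof (cases "\<exists>j\<in>{1..N}. x \<in> ?J j")
    case True
    then obtain j where j: "j \<in> {1..N}" "x \<in> ?J j"
      by blast
    \<comment> \<open>These gaps keep \<open>x\<close> inside cell \<open>j\<close> and
      \<open>x + h\<close> inside cell \<open>j + 1\<close>; they also separate the intervals
      \<open>?J i\<close>.\<close>
    have prev: "p (j - 1) + h < p j" and succ: "p j + h < p (j + 1)"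
      using near[of "j - 1"] near[of j] j by auto
    have "x \<notin> ?J i" if "i \<in> {1..N} - {j}" for i
    proof (cases "i < j")
      case True
      then have "p i \<le> p (j - 1)"
        using j by (intro p_le) auto
      then show ?thesis
        using prev j by auto
    next
      case False
      then have "p j \<le> p (i - 1)" "p (i - 1) + h < p i"
        using that near[of "i - 1"] by (auto intro: p_le)
      then show ?thesis
        using j by auto
    qed
    then have "(\<Sum>j=1..N. ennreal ((c j - c (j + 1))\<^sup>2) * indicator (?J j) x)
      = (\<Sum>i=1..N. if i = j then ennreal ((c j - c (j + 1))\<^sup>2) else 0)"
      using j by (intro sum.cong) auto
    moreover have "step x = c j"
      using j prev by (intro step_eq) auto
    moreover have "step (x + h) = c (j + 1)"
      using j succ by (intro step_eq) auto
    moreover have "a \<le> p (j - 1)" "p (j + 1) \<le> b"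
      using p_le[of 0 "j - 1"] p_le[of "j + 1" "N + 1"] j p_0 p_last by auto
    then have "a < x" "x + h < b"
      using prev succ j by auto
    ultimately show ?thesis
      using j h by (simp only:) (simp add: sum.delta)
  next
    case False
    then have "(\<Sum>j=1..N. ennreal ((c j - c (j + 1))\<^sup>2) * indicator (?J j) x) = 0"
      by (intro sum.neutral) auto
    moreover have "step (x + h) = step x" if ab: "a < x" "x + h < b"
    proof -
      obtain j where j: "1 \<le> j" "j \<le> N + 1" "p (j - 1) < x" "x < p j"
        using obtain_cell[of x] ab h \<open>x \<notin> ?E\<close> by (metis UnI1 add_less_same_cancel1 less_trans not_less_iff_gr_or_eq add.commute less_add_same_cancel1)
      have "x + h \<noteq> p j"
        using \<open>x \<notin> ?E\<close> j(2) by (auto simp: image_iff) (metis add_diff_cancel atMost_iff)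
      \<comment> \<open>Otherwise \<open>p j\<close> would lie strictly between \<open>x\<close> and
        \<open>x + h\<close>, putting \<open>x\<close> in \<open>?J j\<close>. For
        \<open>j = N + 1\<close> the bound is \<open>x + h < b\<close>.\<close>
      then have "x + h < p j"
        using False j ab p_last by (cases "j = N + 1") (auto dest!: bspec[of _ _ j])
      then show ?thesis
        using j h step_eq[of j x] step_eq[of j "x + h"] by simp
    qed
    ultimately show ?thesis
      by (auto split: split_indicator)
  qed
  have "finite ?E"
    by simp
  then have "?E \<in> null_sets lborel"
    by (intro finite_imp_null_set_lborel)
  then have "AE x in lborel. x \<notin> ?E"
    by (rule AE_not_in)
  then have "shift_energy h = (\<integral>\<^sup>+x. (\<Sum>j=1..N. ennreal ((c j - c (j + 1))\<^sup>2) * indicator (?J j) x) \<partial>lborel)"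
    unfolding shift_energy_def by (intro nn_integral_cong_AE) (erule eventually_mono, rule pointwise)
  also have "\<dots> = (\<Sum>j=1..N. \<integral>\<^sup>+x. ennreal ((c j - c (j + 1))\<^sup>2) * indicator (?J j) x \<partial>lborel)"
    by (rule nn_integral_sum) auto
  also have "\<dots> = (\<Sum>j=1..N. ennreal ((c j - c (j + 1))\<^sup>2 * h))"
    using h by (intro sum.cong) (auto simp: nn_integral_cmult_indicator ennreal_mult)
  also have "\<dots> = ennreal (jump_energy * h)"
    using h by (subst sum_ennreal) (auto simp: jump_energy_def sum_distrib_right)
  finally show ?thesis .
qed

lemma obtain_min_cell:
  obtains m where "0 < m" "\<And>i. i \<le> N \<Longrightarrow> m \<le> p (i + 1) - p i"
proof
  let ?D = "(\<lambda>i. p (i + 1) - p i) ` {..N}"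
  have "Min ?D \<in> ?D"
    by (intro Min_in) auto
  then show "0 < Min ?D"
    using p_step by auto
  show "Min ?D \<le> p (i + 1) - p i" if "i \<le> N" for i
    using that by (intro Min_le) auto
qed

end

section \<open>Two-sided bounds and the limit\<close>

context interval_partition
begin

context
  fixes v :: "real \<Rightarrow> real" and u :: "real \<times> real \<Rightarrow> real" and s m \<epsilon> :: real
  assumes v: "AE x in lebesgue. x \<in> {a<..<b} \<longrightarrow> v x = step x"
    and u: "\<And>x y. (x, y) \<in> thin_rect a b \<epsilon> \<Longrightarrow> u (x, y) = v x"
    and s: "0 < s" "s < 1 / 2"
    and m: "0 < m" "\<And>i. i \<le> N \<Longrightarrow> m \<le> p (i + 1) - p i"
    and \<epsilon>: "0 < \<epsilon>" "\<epsilon> \<le> m"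
begin

lemma gagliardo_sq_eq:
  "gagliardo_sq s (thin_rect a b \<epsilon>) u = 4 * (\<integral>\<^sup>+h\<in>{0<..}. shift_energy h * strip_kernel s \<epsilon> h \<partial>lborel)"
  unfolding shift_energy_def
proof (rule gagliardo_sq_thin_rect)
  show "AE z in lebesgue. z \<in> thin_rect a b \<epsilon> \<longrightarrow> u z = step (fst z)"
    using AE_fst_lebesgue[OF v] 
    by eventually_elim (auto simp: thin_rect_def u[unfolded thin_rect_def])
qed measurable

lemma nn_integral_near:
  "(\<integral>\<^sup>+h\<in>{0<..<m}. shift_energy h * strip_kernel s \<epsilon> h \<partial>lborel)
    = ennreal jump_energy * (\<integral>\<^sup>+h\<in>{0<..<m}. ennreal h * strip_kernel s \<epsilon> h \<partial>lborel)"
proof -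
  have "(\<integral>\<^sup>+h\<in>{0<..<m}. shift_energy h * strip_kernel s \<epsilon> h \<partial>lborel)
    = (\<integral>\<^sup>+h. ennreal jump_energy * (ennreal h * strip_kernel s \<epsilon> h * indicator {0<..<m} h) \<partial>lborel)"
    using shift_energy_near[OF m(2)] jump_energy_nonneg
    by (intro nn_integral_cong) (auto simp: ennreal_mult mult.assoc split: split_indicator)
  then show ?thesis
    by (simp add: nn_integral_cmult)
qed

text \<open>The contribution of \<open>h \<ge> m\<close> is nonnegative and is discarded.\<close>

lemma gagliardo_sq_lower:
  "ennreal (4 * (jump_energy * (\<epsilon>\<^sup>2 / 2 * ((\<epsilon> powr (- 2 * s) - m powr (- 2 * s)) / (2 * s)))))
    \<le> gagliardo_sq s (thin_rect a b \<epsilon>) u"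
proof -
  note S = jump_energy_nonneg
  have "ennreal (4 * (jump_energy * (\<epsilon>\<^sup>2 / 2 * ((\<epsilon> powr (- 2 * s) - m powr (- 2 * s)) / (2 * s)))))
    = 4 * (ennreal jump_energy * ennreal (\<epsilon>\<^sup>2 / 2 * ((\<epsilon> powr (- 2 * s) - m powr (- 2 * s)) / (2 * s))))"
    using S by (simp only: ennreal_mult' ennreal_numeral zero_le_numeral)
  also have "\<dots> \<le> 4 * (\<integral>\<^sup>+h\<in>{0<..<m}. shift_energy h * strip_kernel s \<epsilon> h \<partial>lborel)"
    unfolding nn_integral_near using s m(1) \<epsilon> by (intro mult_left_mono strip_kernel_near_lower) auto
  also have "\<dots> \<le> gagliardo_sq s (thin_rect a b \<epsilon>) u"
    unfolding gagliardo_sq_eq by (intro mult_left_mono nn_integral_mono) (auto split: split_indicator)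
  finally show ?thesis .
qed

text \<open>Shifts with \<open>h \<ge> b - a\<close> leave the interval and contribute nothing, so
  the far range is bounded. Of the two factors \<open>b - a\<close> in the error term, one comes
  from integrating over \<open>x\<close> and one from integrating over \<open>h\<close>.\<close>

lemma gagliardo_sq_upper:
  "gagliardo_sq s (thin_rect a b \<epsilon>) u
    \<le> ennreal (4 * (jump_energy * ((\<epsilon> powr (2 - 2 * s) / ((1 - 2 * s) * (2 - 2 * s)) - \<epsilon>\<^sup>2 / 2 * (m\<^sup>2 + \<epsilon>\<^sup>2) powr (- s)) / (2 * s))
      + (2 * (\<Sum>j=1..N+1. \<bar>c j\<bar>))\<^sup>2 * (b - a)\<^sup>2 * (\<epsilon>\<^sup>2 / 2 * m powr (- 2 - 2 * s))))"
    (is "_ \<le> ennreal (4 * (jump_energy * ?hi + _))")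
proof -
  define C where "C = (2 * (\<Sum>j=1..N+1. \<bar>c j\<bar>))\<^sup>2"
  define far where "far = \<epsilon>\<^sup>2 / 2 * m powr (- 2 - 2 * s)"
  have "a \<le> b"
    using p_le[of 0 "N + 1"] p_0 p_last by simp
  note S = jump_energy_nonneg
  have nonneg: "0 \<le> C" "0 \<le> far"
    by (auto simp: C_def far_def)
  have pointwise: "shift_energy h * strip_kernel s \<epsilon> h * indicator {0<..} h
    \<le> shift_energy h * strip_kernel s \<epsilon> h * indicator {0<..<m} h + ennreal (C * (b - a) * far) * indicator {0..b - a} h" for h
  proof (cases "0 < h \<and> m \<le> h \<and> h < b - a")
    case True
    then have "shift_energy h * strip_kernel s \<epsilon> h \<le> ennreal (C * (b - a)) * ennreal far"
      unfolding C_def far_def using s m(1) \<epsilon> \<open>a \<le> b\<close>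
      by (intro mult_mono shift_energy_bounded strip_kernel_far) auto
    then show ?thesis
      using True nonneg \<open>a \<le> b\<close> by (simp add: ennreal_mult)
  next
    case False
    then show ?thesis
      using shift_energy_far[of h] by (auto split: split_indicator)
  qed
  have "(\<integral>\<^sup>+h\<in>{0<..}. shift_energy h * strip_kernel s \<epsilon> h \<partial>lborel)
    \<le> (\<integral>\<^sup>+h. shift_energy h * strip_kernel s \<epsilon> h * indicator {0<..<m} h + ennreal (C * (b - a) * far) * indicator {0..b - a} h \<partial>lborel)"
    by (intro nn_integral_mono pointwise)
  also have "\<dots> = ennreal jump_energy * (\<integral>\<^sup>+h\<in>{0<..<m}. ennreal h * strip_kernel s \<epsilon> h \<partial>lborel)
    + ennreal (C * (b - a) * far) * ennreal (b - a)"
    using \<open>a \<le> b\<close> by (subst nn_integral_add) (auto simp: nn_integral_near nn_integral_cmult_indicator)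
  also have "ennreal (C * (b - a) * far) * ennreal (b - a) = ennreal (C * (b - a)\<^sup>2 * far)"
    using nonneg \<open>a \<le> b\<close> by (subst ennreal_mult[symmetric]) (auto simp: power2_eq_square mult_ac)
  also have "ennreal jump_energy * (\<integral>\<^sup>+h\<in>{0<..<m}. ennreal h * strip_kernel s \<epsilon> h \<partial>lborel)
    \<le> ennreal jump_energy * ennreal ?hi"
    using s m(1) \<epsilon> by (intro mult_left_mono strip_kernel_near_upper) auto
  also have "\<dots> = ennreal (jump_energy * ?hi)"
    using S by (simp only: ennreal_mult')
  also have "ennreal (jump_energy * ?hi) + ennreal (C * (b - a)\<^sup>2 * far) = ennreal (jump_energy * ?hi + C * (b - a)\<^sup>2 * far)"
    using S nonneg strip_kernel_near_upper_nonneg[of s m \<epsilon>] s m(1) \<epsilon> by (intro ennreal_plus[symmetric]) auto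
  finally have "gagliardo_sq s (thin_rect a b \<epsilon>) u \<le> ennreal 4 * ennreal (jump_energy * ?hi + C * (b - a)\<^sup>2 * far)"
    unfolding gagliardo_sq_eq by (simp only: ennreal_numeral) (rule mult_left_mono, auto)
  then show ?thesis
    unfolding C_def far_def by (simp only: ennreal_mult' zero_le_numeral)
qed

end

end

section \<open>Squeezing the rescaled seminorm\<close>

theorem lemma7p1:
  fixes a b \<rho> :: real
    and s :: "real \<Rightarrow> real"
    and v :: "real \<Rightarrow> real"
    and u :: "real \<Rightarrow> real \<times> real \<Rightarrow> real"
  assumes "a < b"
    and "\<And>\<epsilon>. \<epsilon> > 0 \<Longrightarrow> 0 < s \<epsilon> \<and> s \<epsilon> < 1 / 2"
    and "(s \<longlongrightarrow> 0) (at_right 0)"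
    and "((\<lambda>\<epsilon>. \<epsilon> powr s \<epsilon>) \<longlongrightarrow> \<rho>) (at_right 0)"
    and "0 \<le> \<rho>" and "\<rho> \<le> 1"
    and "piecewise_constant_on a b v"
    and "\<And>\<epsilon> x1 x2. \<epsilon> > 0 \<Longrightarrow> (x1, x2) \<in> thin_rect a b \<epsilon> \<Longrightarrow> u \<epsilon> (x1, x2) = v x1"
  shows "(\<forall>\<^sub>F \<epsilon> in at_right 0. gagliardo_sq (s \<epsilon>) (thin_rect a b \<epsilon>) (u \<epsilon>) < \<infinity>) \<and>
    (\<lambda>\<epsilon>. enn2real (gagliardo_sq (s \<epsilon>) (thin_rect a b \<epsilon>) (u \<epsilon>))
       - \<epsilon> powr (2 - 2 * s \<epsilon>) / s \<epsilon> * (1 - \<rho>\<^sup>2)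
         * (\<Sum>t\<in>jump_set a b v. \<bar>right_lim v t - left_lim v t\<bar>\<^sup>2))
    \<in> o[at_right 0](\<lambda>\<epsilon>. \<epsilon> powr (2 - 2 * s \<epsilon>) / s \<epsilon>)"
proof -
  from \<open>piecewise_constant_on a b v\<close> obtain N :: nat and p c :: "nat \<Rightarrow> real"
    where p: "p 0 = a" "p (N + 1) = b" "\<forall>i\<le>N. p i < p (i + 1)"
      and v: "AE x in lebesgue. x \<in> {a<..<b} \<longrightarrow> v x = (\<Sum>j=1..N+1. c j * indicator {p (j - 1)<..<p j} x)"
    unfolding piecewise_constant_on_def by blast
  interpret interval_partition a b N p c
    by unfold_locales (use p in auto)
  have v: "AE x in lebesgue. x \<in> {a<..<b} \<longrightarrow> v x = step x"
    using v by (simp add: step_def)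
  obtain m where m: "0 < m" "\<And>i. i \<le> N \<Longrightarrow> m \<le> p (i + 1) - p i"
    by (rule obtain_min_cell) blast
  define S where "S = jump_energy"
  define C where "C = (2 * (\<Sum>j=1..N+1. \<bar>c j\<bar>))\<^sup>2 * (b - a)\<^sup>2"
  define G where "G \<epsilon> = gagliardo_sq (s \<epsilon>) (thin_rect a b \<epsilon>) (u \<epsilon>)" for \<epsilon>
  define f where "f \<epsilon> = \<epsilon> powr (2 - 2 * s \<epsilon>) / s \<epsilon>" for \<epsilon>
  \<comment> \<open>\<open>lo\<close> and \<open>hi\<close> are the two bounds on the seminorm
    divided by \<open>f\<close>; writing them with \<open>\<epsilon> powr s \<epsilon>\<close>
    brings in the quantity whose limit is \<open>\<rho>\<close>.\<close>
  define lo where "lo \<epsilon> = S * (1 - (\<epsilon> powr s \<epsilon>)\<^sup>2 * m powr (- 2 * s \<epsilon>))" for \<epsilon>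
  define hi where "hi \<epsilon> = S * (2 / ((1 - 2 * s \<epsilon>) * (2 - 2 * s \<epsilon>)) - (\<epsilon> powr s \<epsilon>)\<^sup>2 * (m\<^sup>2 + \<epsilon>\<^sup>2) powr (- s \<epsilon>))
    + 2 * C * s \<epsilon> * (\<epsilon> powr s \<epsilon>)\<^sup>2 * m powr (- 2 - 2 * s \<epsilon>)" for \<epsilon>
  note s = assms(2)
  note [tendsto_intros] = assms(3,4)
  have S: "0 \<le> S"
    unfolding S_def by (rule jump_energy_nonneg)
  have f_pos: "0 < f \<epsilon>" if "0 < \<epsilon>" for \<epsilon>
    using s[OF that] that by (simp add: f_def)
  have small: "\<forall>\<^sub>F \<epsilon> in at_right 0. 0 < \<epsilon> \<and> \<epsilon> \<le> m"
    using m(1) by (auto simp: eventually_at_right_field intro!: exI[of _ m])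
  have square: "\<epsilon>\<^sup>2 = \<epsilon> powr (2 - 2 * s \<epsilon>) * (\<epsilon> powr s \<epsilon>)\<^sup>2" if "0 < \<epsilon>" for \<epsilon>
  proof -
    have "(\<epsilon> powr s \<epsilon>)\<^sup>2 = \<epsilon> powr (2 * s \<epsilon>)"
      using that by (simp add: powr_powr mult.commute flip: powr_numeral)
    then show ?thesis
      using that by (simp add: powr_add[symmetric] powr_numeral)
  qed
  have inverse_square: "\<epsilon> powr (- 2 * s \<epsilon>) = 1 / (\<epsilon> powr s \<epsilon>)\<^sup>2" if "0 < \<epsilon>" for \<epsilon>
    using that by (simp add: powr_minus_divide powr_powr mult.commute flip: powr_numeral)
  have lower: "ennreal (f \<epsilon> * lo \<epsilon>) \<le> G \<epsilon>" and upper: "G \<epsilon> \<le> ennreal (f \<epsilon> * hi \<epsilon>)"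
    if "0 < \<epsilon>" "\<epsilon> \<le> m" for \<epsilon>
  proof -
    have [simp]: "\<epsilon> powr s \<epsilon> \<noteq> 0" "s \<epsilon> \<noteq> 0"
      using that s[of \<epsilon>] by auto
    have "4 * (S * (\<epsilon>\<^sup>2 / 2 * ((\<epsilon> powr (- 2 * s \<epsilon>) - m powr (- 2 * s \<epsilon>)) / (2 * s \<epsilon>)))) = f \<epsilon> * lo \<epsilon>"
      unfolding square[OF that(1)] inverse_square[OF that(1)] f_def lo_def
      by (simp add: right_diff_distrib diff_divide_distrib mult_ac)
    moreover have "ennreal (4 * (S * (\<epsilon>\<^sup>2 / 2 * ((\<epsilon> powr (- 2 * s \<epsilon>) - m powr (- 2 * s \<epsilon>)) / (2 * s \<epsilon>))))) \<le> G \<epsilon>"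
      unfolding S_def G_def using s[of \<epsilon>] that m assms(8)
      by (intro gagliardo_sq_lower[OF v]) auto
    ultimately show "ennreal (f \<epsilon> * lo \<epsilon>) \<le> G \<epsilon>"
      by simp
    \<comment> \<open>The powers are abstracted to letters so that the rearrangement is pure field
      algebra: \<open>X\<close> is \<open>f \<epsilon> * s \<epsilon>\<close>, \<open>E\<close> is
      the square of \<open>\<epsilon> powr s \<epsilon>\<close>, and \<open>t\<close> is
      \<open>s \<epsilon>\<close>.\<close>
    have rearrange: "4 * (S * ((X / K - X * E / 2 * Q) / (2 * t)) + C * (X * E / 2 * P))
      = X / t * (S * (2 / K - E * Q) + 2 * C * t * E * P)" if "t \<noteq> 0" for X K E Q P t :: real
      using that by (simp add: distrib_left right_diff_distrib diff_divide_distrib mult_ac)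
    have "4 * (S * ((\<epsilon> powr (2 - 2 * s \<epsilon>) / ((1 - 2 * s \<epsilon>) * (2 - 2 * s \<epsilon>)) - \<epsilon>\<^sup>2 / 2 * (m\<^sup>2 + \<epsilon>\<^sup>2) powr (- s \<epsilon>)) / (2 * s \<epsilon>))
      + C * (\<epsilon>\<^sup>2 / 2 * m powr (- 2 - 2 * s \<epsilon>))) = f \<epsilon> * hi \<epsilon>"
      unfolding f_def hi_def square[OF that(1)] by (rule rearrange) simp
    moreover have "G \<epsilon> \<le> ennreal (4 * (S * ((\<epsilon> powr (2 - 2 * s \<epsilon>) / ((1 - 2 * s \<epsilon>) * (2 - 2 * s \<epsilon>)) - \<epsilon>\<^sup>2 / 2 * (m\<^sup>2 + \<epsilon>\<^sup>2) powr (- s \<epsilon>)) / (2 * s \<epsilon>))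
      + C * (\<epsilon>\<^sup>2 / 2 * m powr (- 2 - 2 * s \<epsilon>))))"
      unfolding S_def C_def G_def using s[of \<epsilon>] that m assms(8)
      by (intro gagliardo_sq_upper[OF v]) auto
    ultimately show "G \<epsilon> \<le> ennreal (f \<epsilon> * hi \<epsilon>)"
      by simp
  qed
  have "((\<lambda>\<epsilon>. lo \<epsilon>) \<longlongrightarrow> S * (1 - \<rho>\<^sup>2 * m powr (- 2 * 0))) (at_right 0)"
    unfolding lo_def using m(1) by (intro tendsto_intros) auto
  then have lo_lim: "(lo \<longlongrightarrow> S * (1 - \<rho>\<^sup>2)) (at_right 0)"
    using m(1) by simp
  \<comment> \<open>The fraction and the power of \<open>m\<^sup>2 + \<epsilon>\<^sup>2\<close> both
    tend to 1, and the far term vanishes through its explicit factor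
    \<open>s \<epsilon>\<close>.\<close>
  have "((\<lambda>\<epsilon>. hi \<epsilon>) \<longlongrightarrow> S * (2 / ((1 - 2 * 0) * (2 - 2 * 0)) - \<rho>\<^sup>2 * (m\<^sup>2 + 0\<^sup>2) powr (- 0))
      + 2 * C * 0 * \<rho>\<^sup>2 * m powr (- 2 - 2 * 0)) (at_right 0)"
    unfolding hi_def using m(1) by (intro tendsto_intros) auto
  \<comment> \<open>A real upper bound read off from an \<open>ennreal\<close> one must be
    nonnegative, hence the maximum with 0; the limit is unchanged because
    \<open>S * (1 - \<rho>\<^sup>2)\<close> is nonnegative.\<close>
  then have "((\<lambda>\<epsilon>. max 0 (hi \<epsilon>)) \<longlongrightarrow> max 0 (S * (1 - \<rho>\<^sup>2))) (at_right 0)"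
    using m(1) by (intro tendsto_max tendsto_const) simp
  moreover have "0 \<le> S * (1 - \<rho>\<^sup>2)"
    using S \<open>0 \<le> \<rho>\<close> \<open>\<rho> \<le> 1\<close> by (intro mult_nonneg_nonneg) (auto simp: power_le_one)
  ultimately have hi_lim: "((\<lambda>\<epsilon>. max 0 (hi \<epsilon>)) \<longlongrightarrow> S * (1 - \<rho>\<^sup>2)) (at_right 0)"
    by simp
  have finite: "\<forall>\<^sub>F \<epsilon> in at_right 0. G \<epsilon> < \<infinity>"
    using small by eventually_elim (use upper ennreal_less_top in \<open>fastforce intro: le_less_trans\<close>)
  have "((\<lambda>\<epsilon>. enn2real (G \<epsilon>) / f \<epsilon>) \<longlongrightarrow> S * (1 - \<rho>\<^sup>2)) (at_right 0)"
  proof (rule tendsto_sandwich[OF _ _ lo_lim hi_lim])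
    show "\<forall>\<^sub>F \<epsilon> in at_right 0. lo \<epsilon> \<le> enn2real (G \<epsilon>) / f \<epsilon>"
      using small finite
    proof eventually_elim
      case (elim \<epsilon>)
      \<comment> \<open>Finiteness matters here: \<open>enn2real\<close> sends infinity to 0, which
        could break a lower bound.\<close>
      then have "f \<epsilon> * lo \<epsilon> \<le> enn2real (G \<epsilon>)"
        using lower[of \<epsilon>] by (cases "G \<epsilon>") (auto simp: ennreal_le_iff2)
      then show ?case
        using f_pos[of \<epsilon>] elim by (simp add: pos_le_divide_eq mult.commute)
    qed
    show "\<forall>\<^sub>F \<epsilon> in at_right 0. enn2real (G \<epsilon>) / f \<epsilon> \<le> max 0 (hi \<epsilon>)"
      using small
    proof eventually_elim
      case (elim \<epsilon>)
      have "ennreal (f \<epsilon> * hi \<epsilon>) \<le> ennreal (f \<epsilon> * max 0 (hi \<epsilon>))"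
        using f_pos[of \<epsilon>] elim by (intro ennreal_leI mult_left_mono) auto
      with upper[of \<epsilon>] elim have "G \<epsilon> \<le> ennreal (f \<epsilon> * max 0 (hi \<epsilon>))"
        by (blast intro: order_trans)
      then have "enn2real (G \<epsilon>) \<le> f \<epsilon> * max 0 (hi \<epsilon>)"
        using f_pos[of \<epsilon>] elim by (intro enn2real_leI) auto
      then show ?case
        using f_pos[of \<epsilon>] elim by (simp add: pos_divide_le_eq mult.commute)
    qed
  qed
  then have "((\<lambda>\<epsilon>. enn2real (G \<epsilon>) / f \<epsilon> - (1 - \<rho>\<^sup>2) * S) \<longlongrightarrow> S * (1 - \<rho>\<^sup>2) - (1 - \<rho>\<^sup>2) * S) (at_right 0)"
    by (intro tendsto_intros)
  moreover have "\<forall>\<^sub>F \<epsilon> in at_right 0. enn2real (G \<epsilon>) / f \<epsilon> - (1 - \<rho>\<^sup>2) * S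
    = (enn2real (G \<epsilon>) - f \<epsilon> * (1 - \<rho>\<^sup>2) * S) / f \<epsilon>"
    using small by eventually_elim (use f_pos in \<open>force simp: diff_divide_distrib\<close>)
  ultimately have "((\<lambda>\<epsilon>. (enn2real (G \<epsilon>) - f \<epsilon> * (1 - \<rho>\<^sup>2) * S) / f \<epsilon>) \<longlongrightarrow> 0) (at_right 0)"
    by (simp add: mult.commute tendsto_cong)
  moreover have "\<forall>\<^sub>F \<epsilon> in at_right 0. f \<epsilon> \<noteq> 0"
    using small by eventually_elim (use f_pos in force)
  ultimately have "(\<lambda>\<epsilon>. enn2real (G \<epsilon>) - f \<epsilon> * (1 - \<rho>\<^sup>2) * S) \<in> o[at_right 0](f)"
    by (intro smalloI_tendsto)
  with finite show ?thesis
    unfolding sum_jump_set[OF v] by (simp add: G_def f_def[abs_def] S_def)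
qed

end
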